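(* Let $M\in\mathbb{R}^{n\times m}$ and let $(\mathcal{C},\mathcal{R},V)$ be a grammar representation of $M$ (as defined in the context), where $\mathcal{C}=N_{i_1}\$_1 N_{i_2}\$_2\cdots N_{i_n}\$_n$. Given $(\mathcal{C},\mathcal{R},V)$ and a vector $x\in\mathbb{R}^m$, the product $y=Mx$ can be computed in $\mathcal{O}(|\mathcal{C}|+|\mathcal{R}|)$ time using $\mathcal{O}(|\mathcal{R}|)$ words of auxiliary space.
   Context: CSRV representation: for $M\in\mathbb{R}^{n\times m}$, let $V[1,k]$ be an array containing the distinct non-zero values of $M$. The sequence $S$ is obtained by scanning $M$ row by row: for each entry $M[i][j]\neq 0$ one appends the pair $\langle \ell,j\rangle$ where $V[\ell]=M[i][j]$, and at the end of row $i$ one appends a special symbol $\$_i$. Grammar representation: a straight-line program over the terminal alphabet of pairs $\langle \ell,j\rangle$ consists of rules $N_i\to AB$ ($i=1,\dots,q$), one per nonterminal, where each of $A,B$ is either a terminal pair or a nonterminal $N_j$ with $j<i$; no rule contains a symbol $\$_r$. The expansion $\mathrm{exp}(N_i)$ is the string of pairs obtained by repeatedly substituting rules. $\mathcal{R}$ is the set of rules ($|\mathcal{R}|=q$), and $\mathcal{C}=N_{i_1}\$_1\cdots N_{i_n}\$_n$ where, for each $r$, $\mathrm{exp}(N_{i_r})$ is exactly the subsequence of $S$ of pairs representing the non-zero entries of row $r$; thus expanding all nonterminals of $\mathcal{C}$ yields $S$. The triple $(\mathcal{C},\mathcal{R},V)$ is the grammar representation of $M$. Complexity is measured in a word-RAM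 model where arithmetic on reals and indices takes unit time. *)

theory Defs
  imports "Jordan_Normal_Form.Matrix" "HOL-Library.Monad_Syntax"
begin

section \<open>Grammar representation of a matrix\<close>

text \<open>
  All indices start from 0 instead of 1: rows, columns, positions in the array \<open>V\<close>,
  non-terminals and row separators.
\<close>

definition distinct_nonzeros :: "real mat \<Rightarrow> real list \<Rightarrow> bool" where
  "distinct_nonzeros M V \<longleftrightarrow> distinct V \<and> set V = elements_mat M - {0}"

definition position :: "'a list \<Rightarrow> 'a \<Rightarrow> nat" where
  "position V a = (THE l. l < length V \<and> V ! l = a)"

text \<open>
  The block of the CSRV sequence \<open>S\<close> that precedes the \<open>r\<close>-th separator.
\<close>

definition csrv_row :: "real list \<Rightarrow> real mat \<Rightarrow> nat \<Rightarrow> (nat \<times> nat) list" where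
  "csrv_row V M r =
     map (\<lambda>j. (position V (M $$ (r, j)), j)) (filter (\<lambda>j. M $$ (r, j) \<noteq> 0) [0..<dim_col M])"

datatype gsym = Term nat nat | Nonterm nat

type_synonym rules = "(gsym \<times> gsym) list"

fun valid_gsym :: "nat \<Rightarrow> nat \<Rightarrow> nat \<Rightarrow> gsym \<Rightarrow> bool" where
  "valid_gsym k m i (Term l j) \<longleftrightarrow> l < k \<and> j < m"
| "valid_gsym k m i (Nonterm j) \<longleftrightarrow> j < i"

text \<open>
  Entry \<open>i\<close> of the rule list is the pair of right-hand side symbols of non-terminal \<open>i\<close>;
  terminals are the pairs \<open>(l, j)\<close> with \<open>l < k\<close> and \<open>j < m\<close>.
\<close>

definition straight_line :: "nat \<Rightarrow> nat \<Rightarrow> rules \<Rightarrow> bool" where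
  "straight_line k m R \<longleftrightarrow>
     (\<forall>i < length R. valid_gsym k m i (fst (R ! i)) \<and> valid_gsym k m i (snd (R ! i)))"

text \<open>
  \<open>expands R X u\<close>: substituting rules in \<open>X\<close> until only terminals remain gives the string \<open>u\<close>.
  This determines \<open>u\<close>, because every non-terminal has exactly one rule.
\<close>

inductive expands :: "rules \<Rightarrow> gsym \<Rightarrow> (nat \<times> nat) list \<Rightarrow> bool" for R :: rules where
  Term: "expands R (Term l j) [(l, j)]"
| Nonterm: "i < length R \<Longrightarrow> R ! i = (A, B) \<Longrightarrow> expands R A u \<Longrightarrow> expands R B v
    \<Longrightarrow> expands R (Nonterm i) (u @ v)"

datatype csym = NT nat | Sep nat

definition grammar_representation ::
    "real mat \<Rightarrow> csym list \<Rightarrow> rules \<Rightarrow> real list \<Rightarrow> bool" where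
  "grammar_representation M C R V \<longleftrightarrow>
     distinct_nonzeros M V \<and>
     straight_line (length V) (dim_col M) R \<and>
     (\<exists>f. C = concat (map (\<lambda>r. [NT (f r), Sep r]) [0..<dim_row M]) \<and>
          (\<forall>r < dim_row M. expands R (Nonterm (f r)) (csrv_row V M r)))"


section \<open>Word-RAM with unit-cost arithmetic on indices and reals\<close>

text \<open>
  A word holds either an index, i.e. a number below \<open>2 ^ w\<close> for the word length \<open>w\<close>, or a real.
  The input is a read-only array of words and the output a write-only one; neither counts as
  auxiliary space. The auxiliary memory is read-write; its cells with constant addresses play
  the role of registers and are counted too. There is no conversion between reals and indices, in
  particular no rounding, which would make unit-cost real arithmetic unreasonably powerful.
\<close>

datatype cell = Ind nat | Real real

datatype arith_op = Add | Sub | Mul | Div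

text \<open>
  Index arithmetic is modulo \<open>2 ^ w\<close>. Ill-sorted operations and divisions by zero fail.
\<close>

fun arith :: "nat \<Rightarrow> arith_op \<Rightarrow> cell \<Rightarrow> cell \<Rightarrow> cell option" where
  "arith w Add (Ind a) (Ind b) = Some (Ind ((a + b) mod 2 ^ w))"
| "arith w Sub (Ind a) (Ind b) = Some (Ind ((a + 2 ^ w - b) mod 2 ^ w))"
| "arith w Mul (Ind a) (Ind b) = Some (Ind ((a * b) mod 2 ^ w))"
| "arith w Div (Ind a) (Ind b) = (if b = 0 then None else Some (Ind (a div b)))"
| "arith w Add (Real a) (Real b) = Some (Real (a + b))"
| "arith w Sub (Real a) (Real b) = Some (Real (a - b))"
| "arith w Mul (Real a) (Real b) = Some (Real (a * b))"
| "arith w Div (Real a) (Real b) = (if b = 0 then None else Some (Real (a / b)))"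
| "arith w _ _ _ = None"

fun less_cell :: "cell \<Rightarrow> cell \<Rightarrow> bool option" where
  "less_cell (Ind a) (Ind b) = Some (a < b)"
| "less_cell (Real a) (Real b) = Some (a < b)"
| "less_cell _ _ = None"

fun index :: "cell \<Rightarrow> nat option" where
  "index (Ind a) = Some a"
| "index (Real _) = None"

text \<open>
  In \<open>instr\<close>, the numbers \<open>d\<close>, \<open>a\<close>, \<open>b\<close> below are addresses of auxiliary cells and \<open>l\<close> is a
  position in the program:
  \<^item> \<open>Const_Ind d v\<close>, \<open>Const_Real d v\<close>: cell \<open>d\<close> receives the constant \<open>v\<close>;
  \<^item> \<open>Arith op d a b\<close>: cell \<open>d\<close> receives the result of \<open>op\<close> on cells \<open>a\<close> and \<open>b\<close>;
  \<^item> \<open>Copy d a\<close>, \<open>Load d a\<close>: cell \<open>d\<close> receives cell \<open>a\<close>, or the cell whose address is in cell \<open>a\<close>;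
  \<^item> \<open>Store a b\<close>: the cell whose address is in cell \<open>a\<close> receives cell \<open>b\<close>;
  \<^item> \<open>Input d a\<close>: cell \<open>d\<close> receives the input word whose position is in cell \<open>a\<close>;
  \<^item> \<open>Output a b\<close>: the output word whose position is in cell \<open>a\<close> receives cell \<open>b\<close>;
  \<^item> \<open>Jump_Less a b l\<close>: jump to \<open>l\<close> if cell \<open>a\<close> is less than cell \<open>b\<close>.
\<close>

datatype instr =
    Const_Ind nat nat
  | Const_Real nat int
  | Arith arith_op nat nat nat
  | Copy nat nat
  | Load nat nat
  | Store nat nat
  | Input nat nat
  | Output nat nat
  | Jump nat
  | Jump_Less nat nat nat
  | Halt

record config =
  pc :: nat
  mem :: "nat \<Rightarrow> cell"
  out :: "nat \<Rightarrow> cell option"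

text \<open>
  The parameter \<open>s\<close> is the number of auxiliary words available: any access to an auxiliary cell
  with an address \<open>\<ge> s\<close> fails.
\<close>

definition peek :: "nat \<Rightarrow> config \<Rightarrow> nat \<Rightarrow> cell option" where
  "peek s \<sigma> a = (if a < s then Some (mem \<sigma> a) else None)"

definition poke :: "nat \<Rightarrow> config \<Rightarrow> nat \<Rightarrow> cell \<Rightarrow> config option" where
  "poke s \<sigma> a v =
     (if a < s then Some (\<sigma>\<lparr>mem := (mem \<sigma>)(a := v), pc := Suc (pc \<sigma>)\<rparr>) else None)"

fun exec :: "nat \<Rightarrow> nat \<Rightarrow> cell list \<Rightarrow> instr \<Rightarrow> config \<Rightarrow> config option" where
  "exec w s inp (Const_Ind d v) \<sigma> = poke s \<sigma> d (Ind (v mod 2 ^ w))"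
| "exec w s inp (Const_Real d v) \<sigma> = poke s \<sigma> d (Real (of_int v))"
| "exec w s inp (Arith op d a b) \<sigma> =
     do { u \<leftarrow> peek s \<sigma> a; v \<leftarrow> peek s \<sigma> b; z \<leftarrow> arith w op u v; poke s \<sigma> d z }"
| "exec w s inp (Copy d a) \<sigma> = do { u \<leftarrow> peek s \<sigma> a; poke s \<sigma> d u }"
| "exec w s inp (Load d a) \<sigma> =
     do { u \<leftarrow> peek s \<sigma> a; i \<leftarrow> index u; v \<leftarrow> peek s \<sigma> i; poke s \<sigma> d v }"
| "exec w s inp (Store a b) \<sigma> =
     do { u \<leftarrow> peek s \<sigma> a; i \<leftarrow> index u; v \<leftarrow> peek s \<sigma> b; poke s \<sigma> i v }"
| "exec w s inp (Input d a) \<sigma> =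
     do { u \<leftarrow> peek s \<sigma> a; i \<leftarrow> index u;
          if i < length inp then poke s \<sigma> d (inp ! i) else None }"
| "exec w s inp (Output a b) \<sigma> =
     do { u \<leftarrow> peek s \<sigma> a; i \<leftarrow> index u; v \<leftarrow> peek s \<sigma> b;
          Some (\<sigma>\<lparr>out := (out \<sigma>)(i \<mapsto> v), pc := Suc (pc \<sigma>)\<rparr>) }"
| "exec w s inp (Jump l) \<sigma> = Some (\<sigma>\<lparr>pc := l\<rparr>)"
| "exec w s inp (Jump_Less a b l) \<sigma> =
     do { u \<leftarrow> peek s \<sigma> a; v \<leftarrow> peek s \<sigma> b; t \<leftarrow> less_cell u v;
          Some (\<sigma>\<lparr>pc := (if t then l else Suc (pc \<sigma>))\<rparr>) }"
| "exec w s inp Halt \<sigma> = None"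

definition step ::
    "nat \<Rightarrow> nat \<Rightarrow> instr list \<Rightarrow> cell list \<Rightarrow> config \<Rightarrow> config option" where
  "step w s P inp \<sigma> = (if pc \<sigma> < length P then exec w s inp (P ! pc \<sigma>) \<sigma> else None)"

fun steps ::
    "nat \<Rightarrow> nat \<Rightarrow> instr list \<Rightarrow> cell list \<Rightarrow> nat \<Rightarrow> config \<Rightarrow> config option" where
  "steps w s P inp 0 \<sigma> = Some \<sigma>"
| "steps w s P inp (Suc t) \<sigma> = do { \<sigma>' \<leftarrow> step w s P inp \<sigma>; steps w s P inp t \<sigma>' }"

definition initial :: config where
  "initial = \<lparr>pc = 0, mem = (\<lambda>_. Ind 0), out = Map.empty\<rparr>"

definition halted :: "instr list \<Rightarrow> config \<Rightarrow> bool" where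
  "halted P \<sigma> \<longleftrightarrow> pc \<sigma> < length P \<and> P ! pc \<sigma> = Halt"

text \<open>
  With words of length \<open>w\<close>, program \<open>P\<close> halts on input \<open>inp\<close> after exactly \<open>t\<close> instructions without
  accessing cells beyond the first \<open>s\<close> auxiliary ones, and its output is exactly the list \<open>res\<close>.
\<close>

definition computes ::
    "nat \<Rightarrow> instr list \<Rightarrow> cell list \<Rightarrow> cell list \<Rightarrow> nat \<Rightarrow> nat \<Rightarrow> bool" where
  "computes w P inp res t s \<longleftrightarrow>
     (\<exists>\<sigma>. steps w s P inp t initial = Some \<sigma> \<and> halted P \<sigma> \<and>
          out \<sigma> = (\<lambda>i. if i < length res then Some (res ! i) else None))"


section \<open>Layout of the input\<close>

fun gsym_cells :: "gsym \<Rightarrow> cell list" where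
  "gsym_cells (Term l j) = [Ind 0, Ind l, Ind j]"
| "gsym_cells (Nonterm j) = [Ind 1, Ind j, Ind 0]"

fun csym_cells :: "csym \<Rightarrow> cell list" where
  "csym_cells (NT i) = [Ind 0, Ind i]"
| "csym_cells (Sep r) = [Ind 1, Ind r]"

definition vec_cells :: "real vec \<Rightarrow> cell list" where
  "vec_cells x = map Real (list_of_vec x)"

text \<open>
  A header with the lengths of the four arrays, followed by the arrays. The length of \<open>x\<close> is the
  number of columns of the matrix, and the length of \<open>C\<close> is twice its number of rows.
\<close>

definition input_cells :: "csym list \<Rightarrow> rules \<Rightarrow> real list \<Rightarrow> real vec \<Rightarrow> cell list" where
  "input_cells C R V x =
     [Ind (length C), Ind (length R), Ind (length V), Ind (dim_vec x)] @
     concat (map csym_cells C) @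
     concat (map (\<lambda>(A, B). gsym_cells A @ gsym_cells B) R) @
     map Real V @
     vec_cells x"

end

theory Submission
  imports Defs
begin

text \<open>
  The product of \<open>M\<close> with \<open>x\<close> at row \<open>r\<close> is the sum of \<open>V ! l * x $ j\<close> over the pairs \<open>(l, j)\<close> in the
  expansion of the non-terminal of row \<open>r\<close>. This weight is additive under concatenation, so one
  pass over the rules, in order, yields the weights of all non-terminals in an array of length
  \<open>length R\<close>; a second pass over \<open>C\<close> copies the weights of the row non-terminals to the output.
  A row of \<open>M\<close> exists, so there is a rule, and finitely many registers fit in \<open>O(length R)\<close> words.
\<close>

section \<open>Weights of strings of pairs\<close>

definition weight :: "real list \<Rightarrow> real vec \<Rightarrow> (nat \<times> nat) list \<Rightarrow> real" where
  "weight V x u = (\<Sum>(l, j)\<leftarrow>u. V ! l * x $ j)"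

lemma weight_append: "weight V x (u @ v) = weight V x u + weight V x v"
  by (simp add: weight_def)

text \<open>Each non-terminal has a single rule, so two derivations split at the same place. This
  identifies a stored weight, known only to belong to some expansion, with that of the CSRV
  row.\<close>

lemma expands_unique:
  assumes "expands R X u" "expands R X v"
  shows "u = v"
  using assms
proof (induction arbitrary: v rule: expands.induct)
  case (Term l j)
  then show ?case by (auto elim: expands.cases)
next
  case (Nonterm i A B u1 u2)
  from Nonterm.prems obtain A' B' v1 v2 where
    "R ! i = (A', B')" "expands R A' v1" "expands R B' v2" "v = v1 @ v2"
    by (auto elim: expands.cases)
  with Nonterm show ?case by auto
qed

lemma nth_position:
  assumes "distinct V" "a \<in> set V"
  shows "V ! position V a = a"
proof -
  have "\<exists>!l. l < length V \<and> V ! l = a"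
    using assms by (metis distinct_Ex1)
  then show ?thesis
    unfolding position_def by (metis (mono_tags, lifting) theI')
qed

lemma weight_csrv_row:
  assumes "distinct_nonzeros M V" "r < dim_row M" "dim_vec x = dim_col M"
  shows "weight V x (csrv_row V M r) = (M *\<^sub>v x) $ r"
proof -
  have V: "V ! position V (M $$ (r, j)) = M $$ (r, j)"
    if "j < dim_col M" "M $$ (r, j) \<noteq> 0" for j
  proof (rule nth_position)
    have "M $$ (r, j) \<in> elements_mat M"
      using assms(2) that(1) by (intro elements_matI[of M _ _ r j]) auto
    then show "distinct V" "M $$ (r, j) \<in> set V"
      using assms(1) that(2) by (auto simp: distinct_nonzeros_def)
  qed
  have "weight V x (csrv_row V M r) =
      (\<Sum>j\<leftarrow>filter (\<lambda>j. M $$ (r, j) \<noteq> 0) [0..<dim_col M]. M $$ (r, j) * x $ j)"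
    unfolding weight_def csrv_row_def using V
    by (auto simp: o_def intro!: arg_cong[where f = sum_list])
  also have "\<dots> = (\<Sum>j\<leftarrow>[0..<dim_col M]. M $$ (r, j) * x $ j)"
    by (rule sum_list_map_filter) auto
  also have "\<dots> = (M *\<^sub>v x) $ r"
    using assms by (simp add: scalar_prod_def sum_list_sum_nth atLeast0LessThan)
  finally show ?thesis .
qed

section \<open>Running programs\<close>

text \<open>Unfolds a run of concrete length one instruction at a time, so that simp can execute the
  program symbolically.\<close>

lemma steps_numeral:
  "steps w s P inp (numeral k) \<sigma> =
     do { \<sigma>' \<leftarrow> step w s P inp \<sigma>; steps w s P inp (pred_numeral k) \<sigma>' }"
  by (simp add: numeral_eq_Suc)

lemma steps_add:
  "steps w s P inp (t + t') \<sigma> = do { \<sigma>' \<leftarrow> steps w s P inp t \<sigma>; steps w s P inp t' \<sigma>' }"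
  by (induction t arbitrary: \<sigma>) (auto split: bind_splits)

lemma steps_trans:
  assumes "steps w s P inp t \<sigma> = Some \<sigma>'" "steps w s P inp t' \<sigma>' = Some \<sigma>''"
  shows "steps w s P inp (t + t') \<sigma> = Some \<sigma>''"
  using assms by (simp add: steps_add)

text \<open>Normal form for program counters and pointers after repeated increments:
  \<open>a\<close>, \<open>Suc a\<close>, \<open>Suc (Suc a)\<close>, then \<open>a + 3\<close>,
  \<open>a + 4\<close> and so on.\<close>

lemma Suc_add_numeral:
  "Suc (Suc (Suc a)) = a + 3"
  "Suc (a + numeral k) = a + numeral (Num.inc k)"
  by (simp_all add: add_One)

section \<open>The program\<close>

text \<open>
  Cells of the auxiliary memory: 0 holds the constant 1, 1 is the input pointer, 2 the pointer to
  the next value to be written, 3 and 4 are the input positions of \<open>V\<close> and \<open>x\<close>, 8 holds the address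
  10 at which the array of weights starts; the others are scratch. In the second pass cell 2
  is the row, cell 3 the end of \<open>C\<close> and cell 6 the constant 4, the number of input cells per row.
\<close>

definition sym_code :: "nat \<Rightarrow> nat \<Rightarrow> instr list" where
  "sym_code b d =
    [Input 5 1,
     Arith Add 1 1 0,
     Input 6 1,
     Arith Add 1 1 0,
     Jump_Less 5 0 (b + 8),
     Arith Add 6 6 8,
     Load d 6,
     Jump (b + 14),
     Arith Add 6 6 3,
     Input d 6,
     Input 6 1,
     Arith Add 6 6 4,
     Input 6 6,
     Arith Mul d d 6,
     Arith Add 1 1 0]"

text \<open>Jump targets are absolute: 15 to 48 is the loop over the rules, 49 to 55 the transition,
  56 to 62 the loop over the rows. There is no call instruction, so the code for one symbol is
  inlined twice, with results in cells 7 and 9. Both loops test at the end.\<close>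

definition mv_prog :: "instr list" where
  "mv_prog =
    [Const_Ind 0 1,
     Const_Ind 5 0,
     Input 1 5,
     Arith Add 1 1 1,
     Const_Ind 6 4,
     Arith Add 1 1 6,
     Input 3 0,
     Const_Ind 6 6,
     Arith Mul 3 3 6,
     Arith Add 3 3 1,
     Const_Ind 6 2,
     Input 4 6,
     Arith Add 4 4 3,
     Const_Ind 8 10,
     Copy 2 8] @
    sym_code 15 7 @
    sym_code 30 9 @
    [Arith Add 7 7 9,
     Store 2 7,
     Arith Add 2 2 0,
     Jump_Less 1 3 15,
     Const_Ind 1 5,
     Const_Ind 2 0,
     Const_Ind 6 4,
     Const_Ind 5 0,
     Input 3 5,
     Arith Add 3 3 3,
     Arith Add 3 3 6,
     Input 5 1,
     Arith Add 5 5 8,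
     Load 7 5,
     Output 2 7,
     Arith Add 2 2 0,
     Arith Add 1 1 6,
     Jump_Less 1 3 56,
     Halt]"

lemma length_mv_prog: "length mv_prog = 64"
  by (simp add: mv_prog_def sym_code_def)

section \<open>Positions in the input, as arrays of fixed-width records\<close>

lemma concat_nth_uniform:
  assumes "\<And>ys. ys \<in> set xss \<Longrightarrow> length ys = d" "i < length xss" "j < d"
  shows "concat xss ! (d * i + j) = xss ! i ! j"
  using assms
proof (induction xss arbitrary: i)
  case (Cons xs xss)
  then show ?case by (cases i) (auto simp: nth_append)
qed simp

lemma length_concat_uniform:
  assumes "\<And>ys. ys \<in> set xss \<Longrightarrow> length ys = d"
  shows "length (concat xss) = d * length xss"
  using assms by (induction xss) auto

text \<open>\<open>word_length\<close> bounds all pointers into the input, so modular index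
  arithmetic is exact on them. \<open>rows\<close> makes the first iteration of each loop
  legitimate.\<close>

locale mv_input =
  fixes M :: "real mat" and C :: "csym list" and R :: rules and V :: "real list"
    and x :: "real vec" and w :: nat and f :: "nat \<Rightarrow> nat"
  assumes rows: "0 < dim_row M"
    and dim_x: "dim_vec x = dim_col M"
    and nonzeros: "distinct_nonzeros M V"
    and R: "straight_line (length V) (dim_vec x) R"
    and C: "C = concat (map (\<lambda>r. [NT (f r), Sep r]) [0..<dim_row M])"
    and exp_row: "r < dim_row M \<Longrightarrow> expands R (Nonterm (f r)) (csrv_row V M r)"
    and word_length: "length (input_cells C R V x) < 2 ^ w"
begin

abbreviation "inp \<equiv> input_cells C R V x"
abbreviation "n \<equiv> dim_row M"
abbreviation "q \<equiv> length R"
definition "v_pos = 4 + 4 * n + 6 * q"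
definition "x_pos = v_pos + length V"
abbreviation "run \<equiv> steps w (10 + q) mv_prog inp"

lemma f_less: "r < n \<Longrightarrow> f r < q"
  using exp_row[of r] by (auto elim: expands.cases)

lemma q_pos: "0 < q"
  using f_less[OF rows] by linarith

lemma length_C: "length C = 2 * n"
  by (simp add: C length_concat o_def sum_list_triv)

text \<open>Merging each non-terminal with its separator gives one record of width 4 per row, as
  \<open>concat_nth_uniform\<close> requires.\<close>

lemma cells_C:
  "concat (map csym_cells C) = concat (map (\<lambda>r. [Ind 0, Ind (f r), Ind 1, Ind r]) [0..<n])"
proof -
  have "concat (map csym_cells (concat (map (\<lambda>r. [NT (f r), Sep r]) rs))) =
      concat (map (\<lambda>r. [Ind 0, Ind (f r), Ind 1, Ind r]) rs)" for rs
    by (induction rs) auto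
  then show ?thesis unfolding C .
qed

lemma gsym_cells_length: "length (gsym_cells A) = 3"
  by (cases A) auto

lemma length_cells_C: "length (concat (map csym_cells C)) = 4 * n"
  unfolding cells_C by (subst length_concat_uniform[where d = 4]) auto

lemma length_cells_R: "length (concat (map (\<lambda>(A, B). gsym_cells A @ gsym_cells B) R)) = 6 * q"
  by (subst length_concat_uniform[where d = 6]) (auto simp: gsym_cells_length)

lemma length_inp: "length inp = x_pos + dim_vec x"
  using length_cells_C length_cells_R by (simp add: input_cells_def vec_cells_def x_pos_def v_pos_def)

lemma inp_header:
  "inp ! 0 = Ind (2 * n)" "inp ! Suc 0 = Ind q" "inp ! 2 = Ind (length V)"
  by (simp_all add: input_cells_def length_C)

lemma inp_C:
  assumes "r < n"
  shows "inp ! (5 + 4 * r) = Ind (f r)"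
proof -
  have "inp ! (5 + 4 * r) = concat (map csym_cells C) ! (4 * r + 1)"
    using assms length_cells_C by (simp add: input_cells_def nth_append)
  also have "\<dots> = Ind (f r)"
    unfolding cells_C using assms by (subst concat_nth_uniform) auto
  finally show ?thesis .
qed

lemma inp_R:
  assumes "i < q" "j < 6"
  shows "inp ! (4 + 4 * n + 6 * i + j) = (gsym_cells (fst (R ! i)) @ gsym_cells (snd (R ! i))) ! j"
proof -
  have "inp ! (4 + 4 * n + 6 * i + j) =
      concat (map (\<lambda>(A, B). gsym_cells A @ gsym_cells B) R) ! (6 * i + j)"
    using assms length_cells_C length_cells_R by (simp add: input_cells_def nth_append)
  also have "\<dots> = (gsym_cells (fst (R ! i)) @ gsym_cells (snd (R ! i))) ! j"
    using assms by (subst concat_nth_uniform) (auto simp: gsym_cells_length split: prod.splits)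
  finally show ?thesis .
qed

lemma inp_V: "l < length V \<Longrightarrow> inp ! (v_pos + l) = Real (V ! l)"
  using length_cells_C length_cells_R by (simp add: input_cells_def nth_append v_pos_def)

lemma inp_x: "j < dim_vec x \<Longrightarrow> inp ! (x_pos + j) = Real (x $ j)"
  using length_cells_C length_cells_R
  by (simp add: input_cells_def nth_append vec_cells_def x_pos_def v_pos_def list_of_vec_index)

text \<open>With at least one row, the header, \<open>C\<close> and \<open>R\<close> alone take at
  least 8 + 6q input words, which exceeds 10 + j.\<close>

lemma weights_fit: "j < q \<Longrightarrow> 10 + j < 2 ^ w"
  using word_length rows unfolding length_inp x_pos_def v_pos_def by linarith

section \<open>First pass: weights of all non-terminals\<close>

definition constants :: "(nat \<Rightarrow> cell) \<Rightarrow> bool" where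
  "constants \<mu> \<longleftrightarrow>
     \<mu> 0 = Ind 1 \<and> \<mu> 3 = Ind v_pos \<and> \<mu> 4 = Ind x_pos \<and> \<mu> 8 = Ind 10"

text \<open>Loop invariant. Expansion is a relation, hence the existential; that non-terminals have
  expansions is established along with the weights.\<close>

definition weights :: "nat \<Rightarrow> (nat \<Rightarrow> cell) \<Rightarrow> bool" where
  "weights i \<mu> \<longleftrightarrow> (\<forall>j < i. \<exists>u. expands R (Nonterm j) u \<and> \<mu> (10 + j) = Real (weight V x u))"

text \<open>The tag, 0 or 1, is compared with the constant 1. A terminal takes 12 steps to form
  \<open>V ! l * x $ j\<close>; a non-terminal takes 9 steps to look up its weight, already stored
  since its index is below \<open>i\<close>. Abstracting over \<open>b\<close> and \<open>d\<close>
  covers both inlined copies.\<close>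

lemma run_sym_code:
  assumes code: "\<And>k. k < 15 \<Longrightarrow> mv_prog ! (b + k) = sym_code b d ! k" and b: "b + 15 \<le> 64"
    and d: "d = 7 \<or> d = 9"
    and A: "\<And>k. k < 3 \<Longrightarrow> inp ! (p + k) = gsym_cells A ! k" and p: "p + 3 \<le> length inp"
    and valid: "valid_gsym (length V) (dim_vec x) i A" and i: "i < q"
    and \<mu>: "constants \<mu>" "weights i \<mu>" "\<mu> 1 = Ind p"
  shows "\<exists>t \<mu>' u. t \<le> 12 \<and> run t \<lparr>pc = b, mem = \<mu>, out = y\<rparr> = Some \<lparr>pc = b + 15, mem = \<mu>', out = y\<rparr>
    \<and> expands R A u \<and> \<mu>' d = Real (weight V x u) \<and> \<mu>' 1 = Ind (p + 3)
    \<and> (\<forall>a. a \<notin> {1, 5, 6, d} \<longrightarrow> \<mu>' a = \<mu> a)"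
proof -
  \<comment> \<open>The positions are written in the normal form of \<open>Suc_add_numeral\<close>,
    so that simp finds each fetched instruction.\<close>
  have fetch: "mv_prog ! b = Input 5 1" "mv_prog ! Suc b = Arith Add 1 1 0"
    "mv_prog ! Suc (Suc b) = Input 6 1"
    "mv_prog ! (b + 3) = Arith Add 1 1 0" "mv_prog ! (b + 4) = Jump_Less 5 0 (b + 8)"
    "mv_prog ! (b + 5) = Arith Add 6 6 8" "mv_prog ! (b + 6) = Load d 6"
    "mv_prog ! (b + 7) = Jump (b + 14)" "mv_prog ! (b + 8) = Arith Add 6 6 3"
    "mv_prog ! (b + 9) = Input d 6" "mv_prog ! (b + 10) = Input 6 1"
    "mv_prog ! (b + 11) = Arith Add 6 6 4" "mv_prog ! (b + 12) = Input 6 6"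
    "mv_prog ! (b + 13) = Arith Mul d d 6" "mv_prog ! (b + 14) = Arith Add 1 1 0"
    using code[of 0] code[of 1] code[of 2] code[of 3] code[of 4] code[of 5] code[of 6] code[of 7]
      code[of 8] code[of 9] code[of 10] code[of 11] code[of 12] code[of 13] code[of 14]
    by (simp_all add: sym_code_def)
  have bnd: "p + 3 < 2 ^ w" using p word_length by linarith
  show ?thesis
  proof (cases A)
    case (Term l j)
    then have lj: "l < length V" "j < dim_vec x" using valid by auto
    have "v_pos + l < length inp" "x_pos + j < length inp" using lj length_inp by (auto simp: x_pos_def)
    \<comment> \<open>Both forms are needed: the reads stay inside the input, and computing their
      positions does not wrap around.\<close>
    note addr = this this[THEN less_trans, OF word_length]
    have pairs: "inp ! p = Ind 0" "inp ! Suc p = Ind l" "inp ! Suc (Suc p) = Ind j"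
      using A[of 0] A[of 1] A[of 2] Term by auto
    let ?\<mu> = "\<mu>(1 := Ind (p + 3), 5 := Ind 0, 6 := Real (x $ j),
        d := Real (V ! l * x $ j))"
    have "run 12 \<lparr>pc = b, mem = \<mu>, out = y\<rparr> =
        Some \<lparr>pc = b + 15, mem = ?\<mu>, out = y\<rparr>"
      using d b \<mu> p bnd fetch pairs addr inp_V[OF lj(1)] inp_x[OF lj(2)]
      by (auto simp: steps_numeral step_def peek_def poke_def length_mv_prog constants_def
          fun_eq_iff add.commute Suc_add_numeral)
    moreover have "expands R A [(l, j)]" by (simp add: Term expands.Term)
    ultimately show ?thesis using d
      by (intro exI[of _ 12] exI[of _ ?\<mu>] exI[of _ "[(l, j)]"] conjI) (auto simp: weight_def)
  next
    case (Nonterm j)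
    then have j: "j < i" using valid by simp
    then obtain u where u: "expands R A u" "\<mu> (10 + j) = Real (weight V x u)"
      using \<mu>(2) Nonterm by (auto simp: weights_def)
    have addr: "10 + j < 2 ^ w" "j < q" using weights_fit[of j] i j by auto
    have pairs: "inp ! p = Ind 1" "inp ! Suc p = Ind j"
      using A[of 0] A[of 1] Nonterm by auto
    let ?\<mu> = "\<mu>(1 := Ind (p + 3), 5 := Ind 1, 6 := Ind (10 + j),
        d := Real (weight V x u))"
    have "run 9 \<lparr>pc = b, mem = \<mu>, out = y\<rparr> =
        Some \<lparr>pc = b + 15, mem = ?\<mu>, out = y\<rparr>"
      using d b \<mu> p bnd fetch pairs addr u
      by (auto simp: steps_numeral step_def peek_def poke_def length_mv_prog constants_def
          fun_eq_iff add.commute Suc_add_numeral)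
    then show ?thesis using d u
      by (intro exI[of _ 9] exI[of _ ?\<mu>] exI[of _ "u"] conjI) auto
  qed
qed

text \<open>Each symbol costs at most 12 steps; adding, storing, advancing and testing cost 4, hence
  28. The sum is the weight of the concatenated expansions, which extends the invariant to
  \<open>i\<close>.\<close>

lemma run_rule:
  assumes i: "i < q" and \<mu>: "constants \<mu>" "weights i \<mu>"
    and ptr: "\<mu> 1 = Ind (4 + 4 * n + 6 * i)" "\<mu> 2 = Ind (10 + i)"
  shows "\<exists>t \<mu>'. t \<le> 28 \<and> run t \<lparr>pc = 15, mem = \<mu>, out = y\<rparr> =
      Some \<lparr>pc = (if Suc i < q then 15 else 49), mem = \<mu>', out = y\<rparr>
    \<and> constants \<mu>' \<and> weights (Suc i) \<mu>'
    \<and> \<mu>' 1 = Ind (4 + 4 * n + 6 * Suc i) \<and> \<mu>' 2 = Ind (10 + Suc i)"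
proof -
  let ?p = "4 + 4 * n + 6 * i"
  obtain A B where AB: "R ! i = (A, B)" by fastforce
  have valid: "valid_gsym (length V) (dim_vec x) i A" "valid_gsym (length V) (dim_vec x) i B"
    using R i AB by (auto simp: straight_line_def)
  have p: "?p + 6 \<le> v_pos" "v_pos \<le> length inp"
    using i by (auto simp: v_pos_def length_inp x_pos_def)
  have A: "inp ! (?p + k) = gsym_cells A ! k" if "k < 3" for k
    using inp_R[OF i, of k] that AB by (simp add: nth_append gsym_cells_length)
  have B: "inp ! (?p + 3 + k) = gsym_cells B ! k" if "k < 3" for k
    using inp_R[OF i, of "3 + k"] that AB by (simp add: nth_append gsym_cells_length add.assoc)
  have code: "mv_prog ! (15 + k) = sym_code 15 7 ! k" "mv_prog ! (30 + k) = sym_code 30 9 ! k"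
    if "k < 15" for k
    using that by (simp_all add: mv_prog_def nth_append) (simp_all add: sym_code_def nth_append)
  obtain t1 \<mu>1 u where 1: "t1 \<le> 12"
    "run t1 \<lparr>pc = 15, mem = \<mu>, out = y\<rparr> = Some \<lparr>pc = 30, mem = \<mu>1, out = y\<rparr>"
    "expands R A u" "\<mu>1 7 = Real (weight V x u)" "\<mu>1 1 = Ind (?p + 3)"
    "\<And>a. a \<notin> {1, 5, 6, 7} \<Longrightarrow> \<mu>1 a = \<mu> a"
    using run_sym_code[OF code(1) _ _ A _ valid(1) i \<mu> ptr(1), of y] p by auto
  have \<mu>1: "constants \<mu>1" "weights i \<mu>1"
    using \<mu> 1(6) by (auto simp: constants_def weights_def)
  obtain t2 \<mu>2 u' where 2: "t2 \<le> 12"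
    "run t2 \<lparr>pc = 30, mem = \<mu>1, out = y\<rparr> = Some \<lparr>pc = 45, mem = \<mu>2, out = y\<rparr>"
    "expands R B u'" "\<mu>2 9 = Real (weight V x u')" "\<mu>2 1 = Ind (?p + 3 + 3)"
    "\<And>a. a \<notin> {1, 5, 6, 9} \<Longrightarrow> \<mu>2 a = \<mu>1 a"
    using run_sym_code[OF code(2) _ _ B _ valid(2) i \<mu>1 1(5), of y] p by auto
  have \<mu>2: "constants \<mu>2" "weights i \<mu>2"
    using \<mu>1 2(6) by (auto simp: constants_def weights_def)
  let ?z = "Real (weight V x (u @ u'))"
  let ?\<mu>3 = "\<mu>2(7 := ?z, 10 + i := ?z, 2 := Ind (10 + Suc i))"
  have fetch: "mv_prog ! 45 = Arith Add 7 7 9" "mv_prog ! 46 = Store 2 7"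
    "mv_prog ! 47 = Arith Add 2 2 0" "mv_prog ! 48 = Jump_Less 1 3 15"
    by (simp_all add: mv_prog_def sym_code_def)
  have regs: "\<mu>2 7 = Real (weight V x u)" "\<mu>2 2 = Ind (10 + i)" "\<mu>2 1 = Ind (?p + 6)"
    using 1 2 ptr by auto
  \<comment> \<open>The write pointer advances after the last rule too, so 10 + q must fit in a
    word; \<open>weights_fit\<close> stops one short of that.\<close>
  have "11 + i < 2 ^ w"
    using word_length p(2) i rows unfolding v_pos_def by linarith
  \<comment> \<open>The rules end exactly where \<open>V\<close> begins, so comparing the input
    pointer with cell 3 detects the last rule.\<close>
  moreover have "?p + 6 < v_pos \<longleftrightarrow> Suc i < q" by (auto simp: v_pos_def)
  ultimately have 3: "run 4 \<lparr>pc = 45, mem = \<mu>2, out = y\<rparr> =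
      Some \<lparr>pc = (if Suc i < q then 15 else 49), mem = ?\<mu>3, out = y\<rparr>"
    using fetch regs \<mu>2(1) 2(4) i
    by (simp add: steps_numeral step_def peek_def poke_def length_mv_prog constants_def
        weight_append)
  have "expands R (Nonterm i) (u @ u')"
    using i AB 1(3) 2(3) by (rule expands.Nonterm)
  then have "weights (Suc i) ?\<mu>3"
    using \<mu>2(2) by (auto simp: weights_def less_Suc_eq)
  moreover have "constants ?\<mu>3" using \<mu>2(1) by (simp add: constants_def)
  moreover have "?\<mu>3 1 = Ind (4 + 4 * n + 6 * Suc i)" "?\<mu>3 2 = Ind (10 + Suc i)"
    using regs by simp_all
  moreover have "t1 + t2 + 4 \<le> 28" using 1(1) 2(1) by simp
  ultimately show ?thesis
    using steps_trans[OF steps_trans[OF 1(2) 2(2)] 3] by blast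
qed

text \<open>Induction on the number of remaining rules. As the test comes last, the loop is entered
  only with \<open>i < q\<close>, and the base case is contradictory.\<close>

lemma run_rules:
  assumes "i < q" "constants \<mu>" "weights i \<mu>"
    "\<mu> 1 = Ind (4 + 4 * n + 6 * i)" "\<mu> 2 = Ind (10 + i)"
  shows "\<exists>t \<mu>'. t \<le> 28 * (q - i) \<and> run t \<lparr>pc = 15, mem = \<mu>, out = y\<rparr> =
      Some \<lparr>pc = 49, mem = \<mu>', out = y\<rparr> \<and> constants \<mu>' \<and> weights q \<mu>'"
  using assms
proof (induction "q - i" arbitrary: i \<mu>)
  case (Suc d)
  obtain t \<mu>' where 1: "t \<le> 28" "run t \<lparr>pc = 15, mem = \<mu>, out = y\<rparr> =
      Some \<lparr>pc = (if Suc i < q then 15 else 49), mem = \<mu>', out = y\<rparr>"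
    "constants \<mu>'" "weights (Suc i) \<mu>'"
    "\<mu>' 1 = Ind (4 + 4 * n + 6 * Suc i)" "\<mu>' 2 = Ind (10 + Suc i)"
    using run_rule[OF Suc.prems] by blast
  show ?case
  proof (cases "Suc i < q")
    case True
    have "d = q - Suc i" using Suc.hyps(2) by simp
    from Suc.hyps(1)[OF this True 1(3-6)] obtain t' \<mu>'' where 2: "t' \<le> 28 * (q - Suc i)"
      "run t' \<lparr>pc = 15, mem = \<mu>', out = y\<rparr> = Some \<lparr>pc = 49, mem = \<mu>'', out = y\<rparr>"
      "constants \<mu>''" "weights q \<mu>''"
      by blast
    have "t + t' \<le> 28 * (q - i)" using 1(1) 2(1) True by linarith
    moreover have "run (t + t') \<lparr>pc = 15, mem = \<mu>, out = y\<rparr> =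
        Some \<lparr>pc = 49, mem = \<mu>'', out = y\<rparr>"
      using 1(2) 2(2) True by (auto intro: steps_trans)
    ultimately show ?thesis using 2(3,4) by blast
  next
    case False
    then have "q = Suc i" using Suc.prems(1) by simp
    then show ?thesis using 1 by auto
  qed
qed simp

section \<open>Second pass: output of the row weights\<close>

definition res_upto :: "nat \<Rightarrow> nat \<Rightarrow> cell option" where
  "res_upto r = (\<lambda>i. if i < r then Some (Real (weight V x (csrv_row V M i))) else None)"

text \<open>The record of row \<open>r\<close> starts at input position 4 + 4r with a tag, so
  \<open>f r\<close> is found at 5 + 4r, and its weight in cell 10 + f r.\<close>

lemma run_row:
  assumes r: "r < n" and \<mu>: "weights q \<mu>" "\<mu> 0 = Ind 1" "\<mu> 3 = Ind (4 + 4 * n)" "\<mu> 6 = Ind 4"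
    "\<mu> 8 = Ind 10" "\<mu> 1 = Ind (5 + 4 * r)" "\<mu> 2 = Ind r"
  shows "run 7 \<lparr>pc = 56, mem = \<mu>, out = res_upto r\<rparr> =
    Some \<lparr>pc = (if Suc r < n then 56 else 63),
      mem = \<mu>(1 := Ind (5 + 4 * Suc r), 2 := Ind (Suc r), 5 := Ind (10 + f r),
        7 := Real (weight V x (csrv_row V M r))), out = res_upto (Suc r)\<rparr>"
proof -
  have fetch: "mv_prog ! 56 = Input 5 1" "mv_prog ! 57 = Arith Add 5 5 8"
    "mv_prog ! 58 = Load 7 5" "mv_prog ! 59 = Output 2 7" "mv_prog ! 60 = Arith Add 2 2 0"
    "mv_prog ! 61 = Arith Add 1 1 6" "mv_prog ! 62 = Jump_Less 1 3 56"
    by (simp_all add: mv_prog_def sym_code_def)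
  have val: "\<mu> (10 + f r) = Real (weight V x (csrv_row V M r))"
    using \<mu>(1) f_less[OF r] exp_row[OF r] expands_unique by (force simp: weights_def)
  \<comment> \<open>After the last row the pointer is 5 + 4n, one cell past the start of
    \<open>R\<close>; it is still inside the input because there is a rule.\<close>
  have "5 + 4 * r < length inp" "9 + 4 * r < length inp"
    using r q_pos unfolding length_inp x_pos_def v_pos_def by linarith+
  moreover from this have "9 + 4 * r < 2 ^ w" "Suc r < 2 ^ w" using word_length by linarith+
  moreover note weights_fit[OF f_less[OF r]]
  moreover have "9 + 4 * r < 4 + 4 * n \<longleftrightarrow> Suc r < n" by auto
  moreover have "(res_upto r)(r \<mapsto> Real (weight V x (csrv_row V M r))) = res_upto (Suc r)"
    by (auto simp: res_upto_def fun_eq_iff less_Suc_eq)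
  ultimately show ?thesis
    using fetch \<mu>(2-) val inp_C[OF r] f_less[OF r]
    by (simp add: steps_numeral step_def peek_def poke_def length_mv_prog fun_upd_twist
        add.commute)
qed

lemma run_rows:
  assumes "r < n" "weights q \<mu>" "\<mu> 0 = Ind 1" "\<mu> 3 = Ind (4 + 4 * n)" "\<mu> 6 = Ind 4"
    "\<mu> 8 = Ind 10" "\<mu> 1 = Ind (5 + 4 * r)" "\<mu> 2 = Ind r"
  shows "\<exists>t \<mu>'. t \<le> 7 * (n - r) \<and>
    run t \<lparr>pc = 56, mem = \<mu>, out = res_upto r\<rparr> = Some \<lparr>pc = 63, mem = \<mu>', out = res_upto n\<rparr>"
  using assms
proof (induction "n - r" arbitrary: r \<mu>)
  case (Suc d)
  define \<mu>' where "\<mu>' = \<mu>(1 := Ind (5 + 4 * Suc r), 2 := Ind (Suc r), 5 := Ind (10 + f r),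
    7 := Real (weight V x (csrv_row V M r)))"
  have 1: "run 7 \<lparr>pc = 56, mem = \<mu>, out = res_upto r\<rparr> =
    Some \<lparr>pc = (if Suc r < n then 56 else 63), mem = \<mu>', out = res_upto (Suc r)\<rparr>"
    unfolding \<mu>'_def by (rule run_row) fact+
  show ?case
  proof (cases "Suc r < n")
    case True
    have "d = n - Suc r" using Suc.hyps(2) by simp
    moreover have "weights q \<mu>'" using Suc.prems(2) by (simp add: \<mu>'_def weights_def)
    ultimately obtain t \<mu>'' where 2: "t \<le> 7 * (n - Suc r)"
      "run t \<lparr>pc = 56, mem = \<mu>', out = res_upto (Suc r)\<rparr> =
        Some \<lparr>pc = 63, mem = \<mu>'', out = res_upto n\<rparr>"
      using Suc.hyps(1)[of "Suc r" \<mu>'] True Suc.prems by (auto simp: \<mu>'_def)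
    have "7 + t \<le> 7 * (n - r)" using 2(1) True by linarith
    moreover have "run (7 + t) \<lparr>pc = 56, mem = \<mu>, out = res_upto r\<rparr> =
        Some \<lparr>pc = 63, mem = \<mu>'', out = res_upto n\<rparr>"
      using 1 2(2) True by (auto intro: steps_trans)
    ultimately show ?thesis by blast
  next
    case False
    then have "Suc r = n" using Suc.prems(1) by simp
    then show ?thesis using 1 by (intro exI[of _ 7] exI[of _ \<mu>']) auto
  qed
qed simp

section \<open>Initialisation and the transition between the passes\<close>

lemma run_init:
  "\<exists>\<mu>. run 15 initial = Some \<lparr>pc = 15, mem = \<mu>, out = res_upto 0\<rparr>
    \<and> constants \<mu> \<and> \<mu> 1 = Ind (4 + 4 * n) \<and> \<mu> 2 = Ind 10"
proof -
  have fetch: "mv_prog ! 0 = Const_Ind 0 1" "mv_prog ! 1 = Const_Ind 5 0"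
    "mv_prog ! Suc (Suc 0) = Input 1 5" "mv_prog ! 3 = Arith Add 1 1 1" "mv_prog ! 4 = Const_Ind 6 4"
    "mv_prog ! 5 = Arith Add 1 1 6" "mv_prog ! 6 = Input 3 0" "mv_prog ! 7 = Const_Ind 6 6"
    "mv_prog ! 8 = Arith Mul 3 3 6" "mv_prog ! 9 = Arith Add 3 3 1"
    "mv_prog ! 10 = Const_Ind 6 2" "mv_prog ! 11 = Input 4 6" "mv_prog ! 12 = Arith Add 4 4 3"
    "mv_prog ! 13 = Const_Ind 8 10" "mv_prog ! 14 = Copy 2 8"
    by (simp_all add: mv_prog_def sym_code_def)
  have "x_pos < 2 ^ w" using word_length length_inp by linarith
  \<comment> \<open>One row and one rule already give \<open>x_pos\<close> at least 14, so the small
    constants loaded by the program survive reduction modulo \<open>2 ^ w\<close>.\<close>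
  then have "10 < (2 :: nat) ^ w" "4 * n + 4 < 2 ^ w" "q * 6 < 2 ^ w" "v_pos < 2 ^ w"
    "length V + v_pos < 2 ^ w"
    using rows q_pos unfolding x_pos_def v_pos_def by linarith+
  moreover from this(1) have "0 < w" by (cases w) auto
  moreover have "2 < length inp" "inp \<noteq> []"
    unfolding length_0_conv[symmetric] length_inp x_pos_def v_pos_def by linarith+
  ultimately have bounds: "10 < (2 :: nat) ^ w" "4 * n + 4 < 2 ^ w" "q * 6 < 2 ^ w"
    "v_pos < 2 ^ w" "length V + v_pos < 2 ^ w" "0 < w" "2 < length inp" "inp \<noteq> []"
    by blast+
  \<comment> \<open>Net effect of the first six instructions; cell 5 receives 0, which it already
    holds.\<close>
  let ?\<mu>1 = "(\<lambda>_. Ind 0)(0 := Ind 1, 1 := Ind (4 * n + 4), 6 := Ind 4)"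
  let ?\<mu>2 = "?\<mu>1(3 := Ind v_pos, 6 := Ind 2, 4 := Ind x_pos, 8 := Ind 10, 2 := Ind 10)"
  have 1: "run 6 initial = Some \<lparr>pc = 6, mem = ?\<mu>1, out = Map.empty\<rparr>"
    using inp_header(1) bounds fetch(1-6)
    by (simp add: steps_numeral step_def peek_def poke_def length_mv_prog initial_def
        numeral_3_eq_3[symmetric] fun_eq_iff)
  have pos: "q * 6 + (4 * n + 4) = v_pos" "length V + v_pos = x_pos"
    by (simp_all add: v_pos_def x_pos_def)
  have "run 9 \<lparr>pc = 6, mem = ?\<mu>1, out = Map.empty\<rparr> =
      Some \<lparr>pc = 15, mem = ?\<mu>2, out = Map.empty\<rparr>"
    using inp_header(2,3) bounds fetch(7-)
    by (simp add: steps_numeral step_def peek_def poke_def length_mv_prog pos mod_less[OF bounds(4)]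
        mod_less[OF bounds(5)[unfolded pos]] fun_eq_iff)
  with 1 have "run (6 + 9) initial = Some \<lparr>pc = 15, mem = ?\<mu>2, out = Map.empty\<rparr>"
    by (rule steps_trans)
  then show ?thesis
    by (intro exI[of _ ?\<mu>2]) (simp add: constants_def res_upto_def add.commute)
qed

lemma run_middle:
  assumes "constants \<mu>" "weights q \<mu>"
  shows "\<exists>\<mu>'. run 7 \<lparr>pc = 49, mem = \<mu>, out = y\<rparr> = Some \<lparr>pc = 56, mem = \<mu>', out = y\<rparr>
    \<and> weights q \<mu>' \<and> \<mu>' 0 = Ind 1 \<and> \<mu>' 3 = Ind (4 + 4 * n) \<and> \<mu>' 6 = Ind 4 \<and> \<mu>' 8 = Ind 10
    \<and> \<mu>' 1 = Ind 5 \<and> \<mu>' 2 = Ind 0"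
proof -
  let ?\<mu> = "\<mu>(1 := Ind 5, 2 := Ind 0, 6 := Ind 4, 5 := Ind 0, 3 := Ind (4 + 4 * n))"
  have fetch: "mv_prog ! 49 = Const_Ind 1 5" "mv_prog ! 50 = Const_Ind 2 0"
    "mv_prog ! 51 = Const_Ind 6 4" "mv_prog ! 52 = Const_Ind 5 0" "mv_prog ! 53 = Input 3 5"
    "mv_prog ! 54 = Arith Add 3 3 3" "mv_prog ! 55 = Arith Add 3 3 6"
    by (simp_all add: mv_prog_def sym_code_def)
  have "0 < length inp" "v_pos < 2 ^ w"
    using word_length unfolding length_inp x_pos_def v_pos_def by linarith+
  then have "5 < (2 :: nat) ^ w" "4 + 4 * n < 2 ^ w" "inp \<noteq> []"
    using rows unfolding v_pos_def by (linarith | force)+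
  then have "run 7 \<lparr>pc = 49, mem = \<mu>, out = y\<rparr> = Some \<lparr>pc = 56, mem = ?\<mu>, out = y\<rparr>"
    using inp_header(1) fetch
    by (simp add: steps_numeral step_def peek_def poke_def length_mv_prog add.commute)
  \<comment> \<open>Only registers below address 10 are reused, so the array of weights
    survives.\<close>
  moreover have "weights q ?\<mu>" using assms(2) by (simp add: weights_def)
  ultimately show ?thesis
    using assms(1) by (intro exI[of _ ?\<mu>]) (simp add: constants_def)
qed

section \<open>The complete run and its cost\<close>

lemma computes_mult:
  "\<exists>t. computes w mv_prog inp (vec_cells (M *\<^sub>v x)) t (10 + q) \<and> t \<le> 22 + 28 * q + 7 * n"
proof -
  obtain \<mu>0 where 0: "run 15 initial = Some \<lparr>pc = 15, mem = \<mu>0, out = res_upto 0\<rparr>"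
    "constants \<mu>0" "\<mu>0 1 = Ind (4 + 4 * n)" "\<mu>0 2 = Ind 10"
    using run_init by blast
  have "weights 0 \<mu>0" by (simp add: weights_def)
  then obtain t1 \<mu>1 where 1: "t1 \<le> 28 * q" "run t1 \<lparr>pc = 15, mem = \<mu>0, out = res_upto 0\<rparr> =
      Some \<lparr>pc = 49, mem = \<mu>1, out = res_upto 0\<rparr>" "constants \<mu>1" "weights q \<mu>1"
    using run_rules[of 0 \<mu>0 "res_upto 0"] 0 q_pos by auto
  obtain \<mu>2 where 2: "run 7 \<lparr>pc = 49, mem = \<mu>1, out = res_upto 0\<rparr> =
      Some \<lparr>pc = 56, mem = \<mu>2, out = res_upto 0\<rparr>"
    "weights q \<mu>2" "\<mu>2 0 = Ind 1" "\<mu>2 3 = Ind (4 + 4 * n)" "\<mu>2 6 = Ind 4" "\<mu>2 8 = Ind 10"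
    "\<mu>2 1 = Ind 5" "\<mu>2 2 = Ind 0"
    using run_middle[OF 1(3,4)] by blast
  obtain t3 \<mu>3 where 3: "t3 \<le> 7 * n" "run t3 \<lparr>pc = 56, mem = \<mu>2, out = res_upto 0\<rparr> =
      Some \<lparr>pc = 63, mem = \<mu>3, out = res_upto n\<rparr>"
    using run_rows[OF rows 2(2-6)] 2(7,8) by auto
  let ?\<sigma> = "\<lparr>pc = 63, mem = \<mu>3, out = res_upto n\<rparr>"
  have "run (15 + t1 + 7 + t3) initial = Some ?\<sigma>"
    by (intro steps_trans[OF steps_trans[OF steps_trans]]) fact+
  moreover have "halted mv_prog ?\<sigma>"
    by (simp add: halted_def length_mv_prog) (simp add: mv_prog_def sym_code_def)
  moreover have "out ?\<sigma> = (\<lambda>i. if i < length (vec_cells (M *\<^sub>v x))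
      then Some (vec_cells (M *\<^sub>v x) ! i) else None)"
    using weight_csrv_row[OF nonzeros _ dim_x]
    by (auto simp: res_upto_def vec_cells_def list_of_vec_index fun_eq_iff)
  ultimately have "computes w mv_prog inp (vec_cells (M *\<^sub>v x)) (15 + t1 + 7 + t3) (10 + q)"
    unfolding computes_def by blast
  moreover have "15 + t1 + 7 + t3 \<le> 22 + 28 * q + 7 * n" using 1(1) 3(1) by simp
  ultimately show ?thesis by blast
qed

end

theorem theorem3p4:
  shows "\<exists>(P :: instr list) (c :: nat).
    \<forall>(n :: nat) (m :: nat) (M :: real mat) (C :: csym list) (R :: rules) (V :: real list)
      (x :: real vec) (w :: nat).
      0 < n \<and> M \<in> carrier_mat n m \<and> grammar_representation M C R V \<and> x \<in> carrier_vec m \<and>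
      length (input_cells C R V x) < 2 ^ w \<longrightarrow>
      (\<exists>t s. computes w P (input_cells C R V x) (vec_cells (M *\<^sub>v x)) t s \<and>
             t \<le> c * (length C + length R) \<and> s \<le> c * length R)"
proof (rule exI[of _ mv_prog], rule exI[of _ 50], intro allI impI, elim conjE)
  fix n m M C R V x w
  assume A: "0 < n" "M \<in> carrier_mat n m" "grammar_representation M C R V" "x \<in> carrier_vec m"
    "length (input_cells C R V x) < 2 ^ w"
  then obtain f where "mv_input M C R V x w f"
    by (auto simp: grammar_representation_def mv_input_def)
  then interpret mv_input M C R V x w f .
  obtain t where t: "computes w mv_prog inp (vec_cells (M *\<^sub>v x)) t (10 + q)"
    "t \<le> 22 + 28 * q + 7 * dim_row M"
    using computes_mult by blast
  \<comment> \<open>Since q is at least 1, additive constants are absorbed: 22 + 28q is at most 50q,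
    which explains the 50, and so is 10 + q. The term 7n is covered by \<open>length C\<close>,
    which is 2n.\<close>
  obtain k where k: "q = Suc k" using q_pos gr0_implies_Suc by blast
  have "t \<le> 50 * (length C + q)"
    using t(2) unfolding k length_C by simp
  moreover have "10 + q \<le> 50 * q" unfolding k by simp
  ultimately show "\<exists>t s. computes w mv_prog inp (vec_cells (M *\<^sub>v x)) t s \<and>
      t \<le> 50 * (length C + q) \<and> s \<le> 50 * q"
    using t(1) by blast
qed

end
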